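(* Let $N,\Delta$ be positive integers and $w=(\Delta^0,\Delta^1,\dots,\Delta^{N-1})\in\mathbb{Z}^N$. There is no vector $\bar{w}\in\mathbb{Z}^N$ with $\|\bar{w}\|_1<\Delta^{N-1}$ such that $w$ and $\bar{w}$ are equivalent on $\mathbb{Z}^N\cap[-\Delta,\Delta]^N$.
   Context: For a set $S\subseteq\mathbb{R}^N$, two vectors $w,\bar w\in\mathbb{R}^N$ are called equivalent on $S$ if for all $x,y\in S$: $w^Tx\geq w^Ty \iff \bar w^Tx\geq \bar w^Ty$. *)

theory Defs
  imports Complex_Main "Jordan_Normal_Form.Matrix"
begin

text \<open>
  Vectors of \<open>\<real>\<^sup>N\<close> are elements of \<open>carrier_vec N :: real vec set\<close>; coordinates are indexed
  from \<open>0\<close> to \<open>N - 1\<close>.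
\<close>

definition equivalent_on :: "real vec set \<Rightarrow> real vec \<Rightarrow> real vec \<Rightarrow> bool" where
  "equivalent_on S w w' \<longleftrightarrow>
     (\<forall>x\<in>S. \<forall>y\<in>S. w \<bullet> x \<ge> w \<bullet> y \<longleftrightarrow> w' \<bullet> x \<ge> w' \<bullet> y)"

definition integer_vecs :: "nat \<Rightarrow> real vec set" where
  "integer_vecs N = {x \<in> carrier_vec N. \<forall>i<N. x $ i \<in> \<int>}"

definition box_vecs :: "nat \<Rightarrow> real \<Rightarrow> real \<Rightarrow> real vec set" where
  "box_vecs N a b = {x \<in> carrier_vec N. \<forall>i<N. x $ i \<in> {a..b}}"

definition l1_norm :: "real vec \<Rightarrow> real" where
  "l1_norm v = (\<Sum>i<dim_vec v. \<bar>v $ i\<bar>)"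

end

theory Submission
  imports Defs
begin

text \<open>
  The vectors \<open>\<Delta> e\<^sub>i\<close> and \<open>e\<^sub>i\<^sub>+\<^sub>1\<close> lie in the box and have equal \<open>w\<close>-value, so every equivalent
  \<open>w'\<close> satisfies \<open>w'\<^sub>i\<^sub>+\<^sub>1 = \<Delta> w'\<^sub>i\<close>; comparing \<open>e\<^sub>0\<close> with \<open>0\<close> gives \<open>w'\<^sub>0 > 0\<close>, hence \<open>w'\<^sub>0 \<ge> 1\<close> by
  integrality. The last entry of \<open>w'\<close> alone is then at least \<open>\<Delta>\<^sup>N\<^sup>-\<^sup>1\<close>.
\<close>

lemma equivalent_on_eq_iff:
  assumes "equivalent_on S w w'" "x \<in> S" "y \<in> S"
  shows "w \<bullet> x = w \<bullet> y \<longleftrightarrow> w' \<bullet> x = w' \<bullet> y"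
  using assms unfolding equivalent_on_def by (metis order_antisym order_refl)

lemma equivalent_on_less_iff:
  assumes "equivalent_on S w w'" "x \<in> S" "y \<in> S"
  shows "w \<bullet> x < w \<bullet> y \<longleftrightarrow> w' \<bullet> x < w' \<bullet> y"
  using assms unfolding equivalent_on_def by (meson not_le)

text \<open>Covers every test vector: \<open>c\<close> is \<open>real \<Delta>\<close>, 1, or 0 for
  the origin. Zero coordinates fit, as the bound on \<open>c\<close> forces
  \<open>b \<ge> 0\<close>.\<close>

lemma smult_unit_vec_in_box:
  assumes "c \<in> \<int>" "\<bar>c\<bar> \<le> b"
  shows "c \<cdot>\<^sub>v unit_vec N i \<in> integer_vecs N \<inter> box_vecs N (- b) b"
  using assms by (auto simp: integer_vecs_def box_vecs_def unit_vec_def)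

lemma scalar_prod_smult_unit_vec:
  fixes v :: "real vec"
  assumes "v \<in> carrier_vec N" "i < N"
  shows "v \<bullet> (c \<cdot>\<^sub>v unit_vec N i) = c * v $ i"
  using assms by simp

lemma abs_index_le_l1_norm:
  assumes "i < dim_vec v"
  shows "\<bar>v $ i\<bar> \<le> l1_norm v"
  unfolding l1_norm_def using assms by (intro member_le_sum) auto

theorem theorem4:
  fixes N \<Delta> :: nat and w :: "real vec"
  assumes "N \<ge> 1" and "\<Delta> \<ge> 1"
    and "w = vec N (\<lambda>i. real \<Delta> ^ i)"
  shows "\<not> (\<exists>w' \<in> integer_vecs N.
            l1_norm w' < real \<Delta> ^ (N - 1) \<and>
            equivalent_on (integer_vecs N \<inter> box_vecs N (- real \<Delta>) (real \<Delta>)) w w')"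
proof clarify
  fix w'
  assume int: "w' \<in> integer_vecs N" and small: "l1_norm w' < real \<Delta> ^ (N - 1)"
    and equiv: "equivalent_on (integer_vecs N \<inter> box_vecs N (- real \<Delta>) (real \<Delta>)) w w'"
  have w: "w \<in> carrier_vec N" and w': "w' \<in> carrier_vec N"
    using assms(3) int by (auto simp: integer_vecs_def)
  note prods = scalar_prod_smult_unit_vec[OF w] scalar_prod_smult_unit_vec[OF w']
  \<comment> \<open>Deleting \<open>one_smult_vec\<close> keeps the factor 1 in place, so that
    \<open>prods\<close> matches both sides.\<close>
  have step: "w' $ Suc i = real \<Delta> * w' $ i" if "Suc i < N" for i
    using equivalent_on_eq_iff[OF equiv smult_unit_vec_in_box[of "real \<Delta>" _ _ i]
        smult_unit_vec_in_box[of 1 _ _ "Suc i"]] assms that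
    by (simp add: prods del: one_smult_vec)
  \<comment> \<open>The origin is written as 0 times \<open>unit_vec N 0\<close>; the
    \<open>w\<close>-values compared are 0 and 1.\<close>
  have "w' $ 0 > 0"
    using equivalent_on_less_iff[OF equiv smult_unit_vec_in_box[of 0 _ _ 0]
        smult_unit_vec_in_box[of 1 _ _ 0]] assms
    by (simp add: prods del: one_smult_vec)
  moreover have "w' $ 0 \<in> \<int>"
    using int assms(1) by (simp add: integer_vecs_def)
  ultimately have first: "w' $ 0 \<ge> 1"
    using Ints_nonzero_abs_ge1[of "w' $ 0"] by simp
  have entry: "w' $ i = real \<Delta> ^ i * w' $ 0" if "i < N" for i
    using that by (induction i) (simp_all add: step)
  \<comment> \<open>\<open>N \<ge> 1\<close> makes \<open>N - 1\<close> a genuine index.\<close>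
  have "w' $ (N - 1) = real \<Delta> ^ (N - 1) * w' $ 0"
    using assms(1) by (intro entry) simp
  then have "real \<Delta> ^ (N - 1) \<le> \<bar>w' $ (N - 1)\<bar>"
    using mult_left_mono[OF first, of "real \<Delta> ^ (N - 1)"] by simp
  also have "\<dots> \<le> l1_norm w'"
    using w' assms(1) by (intro abs_index_le_l1_norm) auto
  finally show False
    using small by simp
qed

end
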